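(* Let $G$ be a totally ordered abelian group. Let $\Gamma$ be the monoid of nonnegative elements (i.e. elements greater than or equal to the identity element $0$) of $G$, and let $D$ be a nontrivially $\Gamma$-graded integral domain. Then $D$ is not Egyptian.
   Context: An element of the fraction field of an integral domain $D$ is called Egyptian (with respect to $D$) if it can be written as a finite sum $\frac{1}{d_1}+\cdots+\frac{1}{d_n}$ with $d_1,\ldots,d_n$ distinct nonzero elements of $D$. An integral domain $D$ is called Egyptian if every nonzero element of $D$ is Egyptian. If $\Gamma$ is a commutative monoid, written additively, a $\Gamma$-graded ring is a ring $R$ together with a collection of additive subgroups $\{R_g \mid g \in \Gamma\}$ of $R$ such that $R = \bigoplus_{g \in \Gamma} R_g$ and $R_g \cdot R_h \subseteq R_{g+h}$ for all $g,h \in \Gamma$. The grading is nontrivial if $R \neq R_0$. A totally ordered abelian group is an abelian group with a total order compatible with addition. All rings are commutative with identity. *)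

theory Defs
  imports "HOL-Computational_Algebra.Polynomial_Factorial"
begin

(* A finite sum of reciprocals of distinct nonzero elements of 'a is given by the finite set S of
   its denominators. S is required to be nonempty, so the empty sum does not make 0 Egyptian. *)
definition egyptian :: "'a::idom fract \<Rightarrow> bool" where
  "egyptian x \<longleftrightarrow>
    (\<exists>S. finite S \<and> S \<noteq> {} \<and> 0 \<notin> S \<and> x = (\<Sum>d\<in>S. inverse (to_fract d)))"

definition egyptian_domain :: "'a::idom itself \<Rightarrow> bool" where
  "egyptian_domain _ \<longleftrightarrow> (\<forall>x::'a. x \<noteq> 0 \<longrightarrow> egyptian (to_fract x))"

(* The grading monoid is a submonoid \<Gamma> of the additive monoid 'g. The values of R outside \<Gamma>
   are irrelevant. *)
locale graded_ring =
  fixes \<Gamma> :: "'g::comm_monoid_add set" and R :: "'g \<Rightarrow> 'a::comm_ring_1 set"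
  assumes monoid_zero: "0 \<in> \<Gamma>"
    and monoid_add: "g \<in> \<Gamma> \<Longrightarrow> h \<in> \<Gamma> \<Longrightarrow> g + h \<in> \<Gamma>"
    and component_zero: "g \<in> \<Gamma> \<Longrightarrow> 0 \<in> R g"
    and component_add: "g \<in> \<Gamma> \<Longrightarrow> x \<in> R g \<Longrightarrow> y \<in> R g \<Longrightarrow> x + y \<in> R g"
    and component_uminus: "g \<in> \<Gamma> \<Longrightarrow> x \<in> R g \<Longrightarrow> - x \<in> R g"
    and component_mult:
      "g \<in> \<Gamma> \<Longrightarrow> h \<in> \<Gamma> \<Longrightarrow> x \<in> R g \<Longrightarrow> y \<in> R h \<Longrightarrow> x * y \<in> R (g + h)"
    (* The whole ring is the internal direct sum of the components: f g is the component of x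
       in degree g, and it is set to 0 outside \<Gamma> to make f unique. *)
    and direct_sum:
      "\<exists>!f. (\<forall>g\<in>\<Gamma>. f g \<in> R g) \<and> (\<forall>g. g \<notin> \<Gamma> \<longrightarrow> f g = 0) \<and>
        finite {g. f g \<noteq> 0} \<and> x = (\<Sum>g | f g \<noteq> 0. f g)"

definition nontrivially_graded_ring ::
    "'g::comm_monoid_add set \<Rightarrow> ('g \<Rightarrow> 'a::comm_ring_1 set) \<Rightarrow> bool" where
  "nontrivially_graded_ring \<Gamma> R \<longleftrightarrow> graded_ring \<Gamma> R \<and> R 0 \<noteq> UNIV"

end

theory Submission
  imports Defs
begin

text \<open>
  An element of a graded domain has a degree, the largest index of a nonzero homogeneous part.
  In a domain graded by a totally ordered group the top parts of two nonzero elements multiply to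
  a nonzero element, so degrees add under multiplication (\<open>degree_mult\<close>). When all degrees are
  nonnegative, a factor of a nonzero element therefore has at most the degree of that element
  (\<open>degree_le_if_dvd\<close>).

  Suppose that \<open>x\<close> has positive degree and is the sum of the reciprocals of the elements of a
  finite set \<open>S\<close>. Multiplying by the product \<open>P\<close> of \<open>S\<close> clears the denominators
  (\<open>clear_denominators\<close>): \<open>x * P\<close> becomes a sum of cofactors \<open>P / d\<close>. Each cofactor divides
  \<open>P\<close>, so the sum has degree at most that of \<open>P\<close>, whereas \<open>x * P\<close> has strictly larger degree.
  Hence no element of positive degree is Egyptian, and nontriviality of the grading says exactly
  that such elements exist.
\<close>

section \<open>Homogeneous parts\<close>

context graded_ring
begin

definition homogeneous_decomposition :: "'a \<Rightarrow> ('g \<Rightarrow> 'a) \<Rightarrow> bool" where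
  "homogeneous_decomposition x f \<longleftrightarrow> (\<forall>g\<in>\<Gamma>. f g \<in> R g) \<and> (\<forall>g. g \<notin> \<Gamma> \<longrightarrow> f g = 0) \<and>
     finite {g. f g \<noteq> 0} \<and> x = (\<Sum>g | f g \<noteq> 0. f g)"

definition part :: "'a \<Rightarrow> 'g \<Rightarrow> 'a" where
  "part x = (THE f. homogeneous_decomposition x f)"

lemma homogeneous_decomposition_part: "homogeneous_decomposition x (part x)"
proof -
  have "\<exists>!f. homogeneous_decomposition x f"
    unfolding homogeneous_decomposition_def by (rule direct_sum)
  then show ?thesis unfolding part_def by (rule theI')
qed

lemma part_eqI: "homogeneous_decomposition x f \<Longrightarrow> part x = f"
  using direct_sum[of x] homogeneous_decomposition_part[of x]
  unfolding homogeneous_decomposition_def by blast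

lemma part_in: "g \<in> \<Gamma> \<Longrightarrow> part x g \<in> R g"
  and part_outside: "g \<notin> \<Gamma> \<Longrightarrow> part x g = 0"
  and finite_part: "finite {g. part x g \<noteq> 0}"
  and sum_part: "(\<Sum>g | part x g \<noteq> 0. part x g) = x"
  using homogeneous_decomposition_part[of x] by (auto simp: homogeneous_decomposition_def)

lemma sum_part_superset:
  assumes "finite A" "{g. part x g \<noteq> 0} \<subseteq> A"
  shows "(\<Sum>g\<in>A. part x g) = x"
proof -
  have "(\<Sum>g\<in>A. part x g) = (\<Sum>g | part x g \<noteq> 0. part x g)"
    using assms by (intro sum.mono_neutral_right) auto
  then show ?thesis using sum_part[of x] by (rule trans)
qed

lemma part_homogeneous:
  assumes "g \<in> \<Gamma>" "x \<in> R g"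
  shows "part x h = (if h = g then x else 0)"
proof -
  have "{h. (if h = g then x else 0) \<noteq> 0} = (if x = 0 then {} else {g})" by auto
  then have "homogeneous_decomposition x (\<lambda>h. if h = g then x else 0)"
    using assms component_zero by (auto simp: homogeneous_decomposition_def)
  from part_eqI[OF this] show ?thesis by simp
qed

lemma part_add: "part (x + y) g = part x g + part y g"
proof -
  let ?A = "{g. part x g \<noteq> 0} \<union> {g. part y g \<noteq> 0}"
  let ?f = "\<lambda>g. part x g + part y g"
  have fin: "finite ?A" using finite_part by simp
  have sub: "{g. ?f g \<noteq> 0} \<subseteq> ?A" by auto
  have "x + y = (\<Sum>g\<in>?A. part x g) + (\<Sum>g\<in>?A. part y g)"
    using sum_part_superset[OF fin, of x] sum_part_superset[OF fin, of y] by simp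
  also have "\<dots> = (\<Sum>g\<in>?A. ?f g)" by (simp add: sum.distrib)
  also have "\<dots> = (\<Sum>g | ?f g \<noteq> 0. ?f g)"
    by (rule sum.mono_neutral_right[OF fin sub]) auto
  finally have "homogeneous_decomposition (x + y) ?f"
    using finite_subset[OF sub fin] component_add part_in part_outside
    by (simp add: homogeneous_decomposition_def)
  from part_eqI[OF this] show ?thesis by simp
qed

lemma part_zero [simp]: "part 0 g = 0"
  using part_add[of 0 0 g] by simp

lemma part_sum: "part (\<Sum>i\<in>I. x i) g = (\<Sum>i\<in>I. part (x i) g)"
  by (induction I rule: infinite_finite_induct) (simp_all add: part_add)

lemma eq_0_if_part_eq_0: "(\<And>g. part x g = 0) \<Longrightarrow> x = 0"
  using sum_part[of x] by simp

lemma part_mult: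
  "part (x * y) g =
     (\<Sum>(i, j)\<in>{i. part x i \<noteq> 0} \<times> {j. part y j \<noteq> 0}. if g = i + j then part x i * part y j else 0)"
proof -
  have "part (part x i * part y j) g = (if g = i + j then part x i * part y j else 0)"
    if "part x i \<noteq> 0" "part y j \<noteq> 0" for i j
  proof -
    have "i \<in> \<Gamma>" "j \<in> \<Gamma>" using that part_outside by blast+
    then show ?thesis
      by (intro part_homogeneous component_mult monoid_add part_in)
  qed
  moreover have "x * y =
      (\<Sum>(i, j)\<in>{i. part x i \<noteq> 0} \<times> {j. part y j \<noteq> 0}. part x i * part y j)"
    by (subst (1) sum_part[of x, symmetric], subst (1) sum_part[of y, symmetric])
      (simp only: sum_product sum.cartesian_product)
  ultimately show ?thesis
    by (auto simp: part_sum intro!: sum.cong)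
qed

end

section \<open>Degrees in a nonnegatively graded domain\<close>

locale nonneg_graded_domain = graded_ring "{g. 0 \<le> g}" R
  for R :: "'g::linordered_ab_group_add \<Rightarrow> 'a::idom set"
begin

text \<open>The degree of \<open>0\<close> is unspecified, because the maximum is then over the empty set.\<close>

definition degree :: "'a \<Rightarrow> 'g" where
  "degree x = Max {g. part x g \<noteq> 0}"

lemma part_degree_ne_0: "x \<noteq> 0 \<Longrightarrow> part x (degree x) \<noteq> 0"
  using Max_in[OF finite_part[of x]] eq_0_if_part_eq_0[of x] by (auto simp: degree_def)

lemma le_degree: "part x g \<noteq> 0 \<Longrightarrow> g \<le> degree x"
  using finite_part by (simp add: degree_def)

lemma degree_eqI:
  assumes "part x g \<noteq> 0" "\<And>h. part x h \<noteq> 0 \<Longrightarrow> h \<le> g"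
  shows "degree x = g"
  unfolding degree_def using assms finite_part by (intro Max_eqI) auto

lemma degree_nonneg: "x \<noteq> 0 \<Longrightarrow> 0 \<le> degree x"
  using part_degree_ne_0[of x] part_outside[of "degree x" x] by auto

text \<open>
  The order makes the top degree of a product reachable in one way only: if \<open>i\<close> and \<open>j\<close> are at
  most the degrees of \<open>x\<close> and \<open>y\<close> and their sum attains the sum of these degrees, then both
  bounds are equalities. So the top parts of \<open>x\<close> and \<open>y\<close> meet no cancellation.
\<close>

lemma degree_mult:
  assumes "x \<noteq> 0" "y \<noteq> 0"
  shows "degree (x * y) = degree x + degree y"
proof (rule degree_eqI)
  let ?A = "{i. part x i \<noteq> 0} \<times> {j. part y j \<noteq> 0}"
  let ?m = "degree x" and ?n = "degree y"
  have "part (x * y) (?m + ?n) = (\<Sum>p\<in>?A. if p = (?m, ?n) then part x ?m * part y ?n else 0)"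
    unfolding part_mult
  proof (rule sum.cong[OF refl], clarify)
    fix i j assume "part x i \<noteq> 0" "part y j \<noteq> 0"
    then have le: "i \<le> ?m" "j \<le> ?n" by (simp_all add: le_degree)
    have "i = ?m \<and> j = ?n" if "?m + ?n = i + j"
      using le that add_less_le_mono[of i ?m j ?n] add_le_less_mono[of i ?m j ?n]
      by (metis less_irrefl order_le_less)
    then show "(if ?m + ?n = i + j then part x i * part y j else 0) =
        (if (i, j) = (?m, ?n) then part x ?m * part y ?n else 0)" by auto
  qed
  also have "\<dots> = part x ?m * part y ?n"
    using assms part_degree_ne_0 finite_part by (simp add: sum.delta)
  finally show "part (x * y) (?m + ?n) \<noteq> 0"
    using assms part_degree_ne_0 by simp
next
  fix h assume "part (x * y) h \<noteq> 0"
  then obtain i j where "part x i \<noteq> 0" "part y j \<noteq> 0" "h = i + j"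
    unfolding part_mult by (force elim: sum.not_neutral_contains_not_neutral split: if_splits)
  then show "h \<le> degree x + degree y" by (simp add: add_mono le_degree)
qed

lemma degree_le_if_dvd:
  assumes "x dvd y" "y \<noteq> 0"
  shows "degree x \<le> degree y"
proof -
  from assms obtain z where "y = x * z" "x \<noteq> 0" "z \<noteq> 0" by auto
  then show ?thesis by (simp add: degree_mult degree_nonneg)
qed

lemma degree_sum_le:
  assumes "(\<Sum>i\<in>I. x i) \<noteq> 0" "\<And>i. i \<in> I \<Longrightarrow> x i \<noteq> 0 \<Longrightarrow> degree (x i) \<le> n"
  shows "degree (\<Sum>i\<in>I. x i) \<le> n"
proof -
  have "(\<Sum>i\<in>I. part (x i) (degree (\<Sum>i\<in>I. x i))) \<noteq> 0"
    using part_degree_ne_0[OF assms(1)] by (simp only: part_sum not_False_eq_True)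
  then obtain i where "i \<in> I" "part (x i) (degree (\<Sum>i\<in>I. x i)) \<noteq> 0"
    by (rule sum.not_neutral_contains_not_neutral)
  with assms(2) show ?thesis by (metis le_degree order_trans part_zero)
qed

lemma ex_degree_pos:
  assumes "R 0 \<noteq> UNIV"
  obtains x where "x \<noteq> 0" "0 < degree x"
proof -
  from assms obtain x where x: "x \<notin> R 0" by auto
  then have "x \<noteq> 0" using component_zero by auto
  moreover have "degree x \<noteq> 0"
  proof
    assume "degree x = 0"
    with \<open>x \<noteq> 0\<close> have "{g. part x g \<noteq> 0} = {0}"
      using part_degree_ne_0[of x] le_degree[of x] part_outside[of _ x] by force
    with sum_part[of x] have "x = part x 0" by simp
    with x part_in[of 0 x] show False by simp
  qed
  ultimately show thesis using that degree_nonneg[of x] by force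
qed

end

section \<open>Egyptian elements\<close>

lemma to_fract_sum: "to_fract (\<Sum>i\<in>I. x i) = (\<Sum>i\<in>I. to_fract (x i))"
  by (induction I rule: infinite_finite_induct) simp_all

lemma clear_denominators:
  fixes x :: "'a::idom"
  assumes S: "finite S" "0 \<notin> S" and x: "to_fract x = (\<Sum>d\<in>S. inverse (to_fract d))"
  shows "x * \<Prod>S = (\<Sum>d\<in>S. \<Prod>(S - {d}))"
proof -
  have "inverse (to_fract d) * to_fract (\<Prod>S) = to_fract (\<Prod>(S - {d}))" if "d \<in> S" for d
  proof -
    have "d \<noteq> 0" using that S by auto
    then show ?thesis using that S by (simp add: prod.remove[of S d])
  qed
  then have "to_fract (x * \<Prod>S) = to_fract (\<Sum>d\<in>S. \<Prod>(S - {d}))"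
    by (simp add: x sum_distrib_right to_fract_sum)
  then show ?thesis by (simp only: to_fract_eq_iff)
qed

lemma (in nonneg_graded_domain) not_egyptian_if_degree_pos:
  assumes "x \<noteq> 0" "0 < degree x"
  shows "\<not> egyptian (to_fract x)"
proof
  assume "egyptian (to_fract x)"
  then obtain S where S: "finite S" "0 \<notin> S" "to_fract x = (\<Sum>d\<in>S. inverse (to_fract d))"
    by (auto simp: egyptian_def)
  let ?P = "\<Prod>S"
  have P: "?P \<noteq> 0" using S by auto
  have eq: "x * ?P = (\<Sum>d\<in>S. \<Prod>(S - {d}))"
    using S by (rule clear_denominators)
  have "degree (x * ?P) \<le> degree ?P"
    unfolding eq
  proof (rule degree_sum_le)
    show "(\<Sum>d\<in>S. \<Prod>(S - {d})) \<noteq> 0"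
      using assms P by (simp flip: eq)
    show "degree (\<Prod>(S - {d})) \<le> degree ?P" for d
      using S P by (intro degree_le_if_dvd prod_dvd_prod_subset) auto
  qed
  with assms P show False by (simp add: degree_mult)
qed

theorem proposition2p3:
  fixes D :: "'g::linordered_ab_group_add \<Rightarrow> 'a::idom set"
  assumes "nontrivially_graded_ring {g. 0 \<le> g} D"
  shows "\<not> egyptian_domain TYPE('a)"
proof -
  interpret nonneg_graded_domain D
    using assms by (simp add: nontrivially_graded_ring_def nonneg_graded_domain_def)
  from assms obtain x where "x \<noteq> 0" "0 < degree x"
    using ex_degree_pos by (auto simp: nontrivially_graded_ring_def)
  then show ?thesis
    using not_egyptian_if_degree_pos by (auto simp: egyptian_domain_def)
qed

end
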